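(* For every $\varphi\in\mathsf{Form}_\Box$: if $\mathcal{MM}(\mathsf{CPC},\mathsf{IPC})\models\varphi$, then $\mathcal{CMM}\models\varphi$.
   Context: The modal language $\mathsf{Form}_\Box$ is generated by $\top$, $\bot$, propositional variables $p\in\mathsf{Prop}$, and $(\varphi\wedge\psi)$, $(\varphi\vee\psi)$, $(\varphi\to\psi)$, $\Box\varphi$; $\neg\varphi$ abbreviates $\varphi\to\bot$. $\mathsf{IPC}$ (over the modal language) is the Hilbert system whose axioms are all instances, with $A,B,C\in\mathsf{Form}_\Box$, of $A\to(B\to A)$; $(A\to B)\to((A\to(B\to C))\to(A\to C))$; $A\to(A\vee B)$; $B\to(A\vee B)$; $(A\vee B)\to((A\to C)\to((B\to C)\to C))$; $A\to(B\to(A\wedge B))$; $(A\wedge B)\to A$; $(A\wedge B)\to B$; $\bot\to A$; its only rule is modus ponens. $\mathsf{CPC}$ adds $\neg A\vee A$. $\Gamma\vdash_L\varphi$ denotes derivability from hypotheses $\Gamma$ using axioms of $L$ and modus ponens. The class $\mathcal{MM}(\mathsf{CPC},\mathsf{IPC})$ consists of triples $\langle W,R,\{T_w\}_{w\in W}\rangle$ with $W\ne\emptyset$, $R\subseteq W\times W$, $T_w\subseteq\mathsf{Form}_\Box$, such that for each $w$ there is $L_w\in\{\mathsf{CPC},\mathsf{IPC}\}$ with: (1) $\bot\notin T_w$; (2) $T_w\vdash_{L_w}\varphi\Rightarrow\varphi\in T_w$; (3) $\Box\varphi\in T_w$ iff $\varphi\in T_v$ for all $v$ with $wRv$; (4)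 $\neg\Box\varphi\in T_w$ iff $\varphi\notin T_v$ for some $v$ with $wRv$. $\mathcal{MM}(\mathsf{CPC},\mathsf{IPC})\models\varphi$ means $\varphi\in T_w$ for every such model and every $w\in W$. A concrete mixed model is $\langle W,R,\{\mathcal M_w\}_{w\in W}\rangle$ with $W\ne\emptyset$, $R\subseteq W\times W$, each $\mathcal M_w=\langle W_w,\leq_w,V_w\rangle$ a rooted intuitionistic Kripke model (partial order $\leq_w$, valuation $V_w:W_w\to\mathcal P(\mathsf{Prop})$ monotone in $\leq_w$) with root $\overline w$, domains pairwise disjoint; $\leq,V$ denote the unions. Forcing at a point $x\in\bigcup_wW_w$: $x\Vdash p$ iff $p\in V(x)$; $x\nVdash\bot$; $\wedge,\vee$ pointwise; $x\Vdash\varphi\to\psi$ iff every $y\geq x$ forcing $\varphi$ forces $\psi$; $x\Vdash\Box\varphi$ iff $\overline v\Vdash\varphi$ for all $v\in W$ with $wRv$, where $w$ is the unique element with $\overline w\leq x$. $\mathcal{CMM}$ is the class of concrete mixed models, and $\mathcal{CMM}\models\varphi$ means $\varphi$ is forced at every point of every concrete mixed model. *)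

theory Defs
  imports Main "HOL-Library.Disjoint_Sets"
begin

datatype 'p form =
    Top
  | Bot
  | Var 'p
  | Conj "'p form" "'p form"
  | Disj "'p form" "'p form"
  | Imp "'p form" "'p form"
  | Box "'p form"

abbreviation Neg :: "'p form \<Rightarrow> 'p form" where
  "Neg A \<equiv> Imp A Bot"

text \<open>A propositional logic is represented by its set of axioms.  There is no axiom for
  \<^const>\<open>Top\<close>: the Hilbert system has none.\<close>

inductive_set IPC :: "'p form set" where
  "Imp A (Imp B A) \<in> IPC"
| "Imp (Imp A B) (Imp (Imp A (Imp B C)) (Imp A C)) \<in> IPC"
| "Imp A (Disj A B) \<in> IPC"
| "Imp B (Disj A B) \<in> IPC"
| "Imp (Disj A B) (Imp (Imp A C) (Imp (Imp B C) C)) \<in> IPC"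
| "Imp A (Imp B (Conj A B)) \<in> IPC"
| "Imp (Conj A B) A \<in> IPC"
| "Imp (Conj A B) B \<in> IPC"
| "Imp Bot A \<in> IPC"

definition CPC :: "'p form set" where
  "CPC = IPC \<union> {Disj (Neg A) A | A. True}"

inductive derivable :: "'p form set \<Rightarrow> 'p form set \<Rightarrow> 'p form \<Rightarrow> bool"
  for L \<Gamma> where
  hyp: "A \<in> \<Gamma> \<Longrightarrow> derivable L \<Gamma> A"
| ax: "A \<in> L \<Longrightarrow> derivable L \<Gamma> A"
| mp: "derivable L \<Gamma> (Imp A B) \<Longrightarrow> derivable L \<Gamma> A \<Longrightarrow> derivable L \<Gamma> B"

definition mixed_model ::
  "'w set \<Rightarrow> ('w \<times> 'w) set \<Rightarrow> ('w \<Rightarrow> 'p form set) \<Rightarrow> bool" where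
  "mixed_model W R T \<longleftrightarrow>
     W \<noteq> {} \<and> R \<subseteq> W \<times> W \<and>
     (\<forall>w\<in>W. \<exists>L\<in>{CPC, IPC}.
        Bot \<notin> T w \<and>
        (\<forall>\<phi>. derivable L (T w) \<phi> \<longrightarrow> \<phi> \<in> T w) \<and>
        (\<forall>\<phi>. Box \<phi> \<in> T w \<longleftrightarrow> (\<forall>v. (w, v) \<in> R \<longrightarrow> \<phi> \<in> T v)) \<and>
        (\<forall>\<phi>. Neg (Box \<phi>) \<in> T w \<longleftrightarrow> (\<exists>v. (w, v) \<in> R \<and> \<phi> \<notin> T v)))"

text \<open>HOL cannot quantify over types inside a formula, so validity is relative to the type
  from which the worlds are drawn.\<close>

definition MM_valid :: "'w itself \<Rightarrow> 'p form \<Rightarrow> bool" where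
  "MM_valid _ \<phi> \<longleftrightarrow>
     (\<forall>(W :: 'w set) R T. mixed_model W R T \<longrightarrow> (\<forall>w\<in>W. \<phi> \<in> T w))"

record ('x, 'p) kripke =
  Dom :: "'x set"
  Le :: "('x \<times> 'x) set"
  Val :: "'x \<Rightarrow> 'p set"

definition int_kripke :: "('x, 'p) kripke \<Rightarrow> bool" where
  "int_kripke M \<longleftrightarrow>
     partial_order_on (Dom M) (Le M) \<and>
     (\<forall>(x, y) \<in> Le M. Val M x \<subseteq> Val M y)"

definition is_root :: "('x, 'p) kripke \<Rightarrow> 'x \<Rightarrow> bool" where
  "is_root M r \<longleftrightarrow> r \<in> Dom M \<and> (\<forall>x\<in>Dom M. (r, x) \<in> Le M)"

definition root_of :: "('x, 'p) kripke \<Rightarrow> 'x" where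
  "root_of M = (THE r. is_root M r)"

definition concrete_mixed_model ::
  "'w set \<Rightarrow> ('w \<times> 'w) set \<Rightarrow> ('w \<Rightarrow> ('x, 'p) kripke) \<Rightarrow> bool" where
  "concrete_mixed_model W R M \<longleftrightarrow>
     W \<noteq> {} \<and> R \<subseteq> W \<times> W \<and>
     (\<forall>w\<in>W. int_kripke (M w) \<and> (\<exists>r. is_root (M w) r)) \<and>
     disjoint_family_on (\<lambda>w. Dom (M w)) W"

definition points :: "'w set \<Rightarrow> ('w \<Rightarrow> ('x, 'p) kripke) \<Rightarrow> 'x set" where
  "points W M = (\<Union>w\<in>W. Dom (M w))"

definition le_union :: "'w set \<Rightarrow> ('w \<Rightarrow> ('x, 'p) kripke) \<Rightarrow> ('x \<times> 'x) set" where
  "le_union W M = (\<Union>w\<in>W. Le (M w))"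

text \<open>The total function \<^term>\<open>Val (M w)\<close> is meaningful only on \<^term>\<open>Dom (M w)\<close>; the
  union of the valuations is taken over these domains.\<close>

definition val_union :: "'w set \<Rightarrow> ('w \<Rightarrow> ('x, 'p) kripke) \<Rightarrow> 'x \<Rightarrow> 'p set" where
  "val_union W M x = (\<Union>w\<in>{w \<in> W. x \<in> Dom (M w)}. Val (M w) x)"

definition world_of :: "'w set \<Rightarrow> ('w \<Rightarrow> ('x, 'p) kripke) \<Rightarrow> 'x \<Rightarrow> 'w" where
  "world_of W M x = (THE w. w \<in> W \<and> (root_of (M w), x) \<in> le_union W M)"

primrec forces ::
  "'w set \<Rightarrow> ('w \<times> 'w) set \<Rightarrow> ('w \<Rightarrow> ('x, 'p) kripke) \<Rightarrow> 'x \<Rightarrow> 'p form \<Rightarrow> bool" where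
  "forces W R M x Top \<longleftrightarrow> True"
| "forces W R M x Bot \<longleftrightarrow> False"
| "forces W R M x (Var p) \<longleftrightarrow> p \<in> val_union W M x"
| "forces W R M x (Conj \<phi> \<psi>) \<longleftrightarrow> forces W R M x \<phi> \<and> forces W R M x \<psi>"
| "forces W R M x (Disj \<phi> \<psi>) \<longleftrightarrow> forces W R M x \<phi> \<or> forces W R M x \<psi>"
| "forces W R M x (Imp \<phi> \<psi>) \<longleftrightarrow>
     (\<forall>y. (x, y) \<in> le_union W M \<longrightarrow> forces W R M y \<phi> \<longrightarrow> forces W R M y \<psi>)"
| "forces W R M x (Box \<phi>) \<longleftrightarrow>
     (\<forall>v\<in>W. (world_of W M x, v) \<in> R \<longrightarrow> forces W R M (root_of (M v)) \<phi>)"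

definition CMM_valid :: "'w itself \<Rightarrow> 'x itself \<Rightarrow> 'p form \<Rightarrow> bool" where
  "CMM_valid _ _ \<phi> \<longleftrightarrow>
     (\<forall>(W :: 'w set) R (M :: 'w \<Rightarrow> ('x, 'p) kripke).
        concrete_mixed_model W R M \<longrightarrow> (\<forall>x\<in>points W M. forces W R M x \<phi>))"

end

theory Submission
  imports Defs
begin

text \<open>The formulas forced at the root of each \<open>M w\<close> form a mixed model in which every world is
  governed by \<open>IPC\<close>; negated boxes behave classically because all points of \<open>M w\<close> force the same
  boxed formulas. Hence a valid formula is forced at all roots, and by persistence at all points.\<close>

context
  fixes W :: "'w set" and R :: "('w \<times> 'w) set" and M :: "'w \<Rightarrow> ('x, 'p) kripke"
  assumes model: "concrete_mixed_model W R M"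
begin

lemma Le_partial_order:
  assumes "w \<in> W"
  shows "Le (M w) \<subseteq> Dom (M w) \<times> Dom (M w)" "refl_on (Dom (M w)) (Le (M w))"
    "trans (Le (M w))" "antisym (Le (M w))"
  using model assms
  unfolding concrete_mixed_model_def int_kripke_def partial_order_on_def preorder_on_def
  by auto

lemma Val_mono:
  assumes "w \<in> W" "(x, y) \<in> Le (M w)"
  shows "Val (M w) x \<subseteq> Val (M w) y"
  using model assms unfolding concrete_mixed_model_def int_kripke_def by blast

lemma Dom_unique:
  assumes "w \<in> W" "v \<in> W" "x \<in> Dom (M w)" "x \<in> Dom (M v)"
  shows "w = v"
  using model assms unfolding concrete_mixed_model_def disjoint_family_on_def by blast

text \<open>Antisymmetry makes the root unique, so the description in \<open>root_of\<close> denotes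
  it.\<close>

lemma is_root_root_of:
  assumes "w \<in> W"
  shows "is_root (M w) (root_of (M w))"
proof -
  obtain r where r: "is_root (M w) r"
    using model assms unfolding concrete_mixed_model_def by blast
  have "s = r" if "is_root (M w) s" for s
    using r that Le_partial_order(4)[OF assms] unfolding is_root_def antisym_def by blast
  with r show ?thesis
    unfolding root_of_def by (rule theI)
qed

lemma root_of_in_Dom: "w \<in> W \<Longrightarrow> root_of (M w) \<in> Dom (M w)"
  using is_root_root_of unfolding is_root_def by blast

lemma root_of_Le: "w \<in> W \<Longrightarrow> x \<in> Dom (M w) \<Longrightarrow> (root_of (M w), x) \<in> Le (M w)"
  using is_root_root_of unfolding is_root_def by blast

text \<open>Disjoint domains keep the union order from leaving a component: a pair starting in
  \<open>Dom (M w)\<close> can only come from \<open>Le (M w)\<close>.\<close>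

lemma le_union_iff:
  assumes "w \<in> W" "x \<in> Dom (M w)"
  shows "(x, y) \<in> le_union W M \<longleftrightarrow> (x, y) \<in> Le (M w)"
  using assms Dom_unique Le_partial_order(1) unfolding le_union_def by blast

lemma le_union_refl:
  assumes "w \<in> W" "x \<in> Dom (M w)"
  shows "(x, x) \<in> le_union W M"
  using assms Le_partial_order(2) le_union_iff by (meson refl_onD)

text \<open>The root of \<open>M v\<close> lies below points of \<open>M v\<close> only, and the
  domains are disjoint, so the description in \<open>world_of\<close> has exactly one
  solution.\<close>

lemma world_of_eq:
  assumes "w \<in> W" "x \<in> Dom (M w)"
  shows "world_of W M x = w"
  unfolding world_of_def
proof (rule the_equality)
  show "w \<in> W \<and> (root_of (M w), x) \<in> le_union W M"
    using assms root_of_Le unfolding le_union_def by blast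
next
  fix v assume "v \<in> W \<and> (root_of (M v), x) \<in> le_union W M"
  then have "v \<in> W" "x \<in> Dom (M v)"
    using le_union_iff root_of_in_Dom Le_partial_order(1) by blast+
  then show "v = w"
    using Dom_unique assms by blast
qed

lemma val_union_eq:
  assumes "w \<in> W" "x \<in> Dom (M w)"
  shows "val_union W M x = Val (M w) x"
  using assms Dom_unique unfolding val_union_def by blast

lemma le_unionE:
  assumes "(x, y) \<in> le_union W M"
  obtains w where "w \<in> W" "x \<in> Dom (M w)" "y \<in> Dom (M w)" "(x, y) \<in> Le (M w)"
  using assms Le_partial_order(1) unfolding le_union_def by blast

lemma le_union_trans:
  assumes "(x, y) \<in> le_union W M" "(y, z) \<in> le_union W M"
  shows "(x, z) \<in> le_union W M"
  using assms by (meson le_unionE le_union_iff Le_partial_order(3) transD)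

text \<open>Persistence. Variables use monotone valuations and implications use transitivity. For a
  box, comparable points lie in the same component, so both are evaluated at the same world.\<close>

lemma forces_mono:
  assumes "(x, y) \<in> le_union W M" "forces W R M x \<psi>"
  shows "forces W R M y \<psi>"
  using assms
proof (induction \<psi>)
  case (Var p)
  then show ?case
    by (auto elim!: le_unionE simp: val_union_eq dest: subsetD[OF Val_mono])
next
  case (Imp \<psi> \<chi>)
  then show ?case
    using le_union_trans by (metis forces.simps(6))
next
  case (Box \<psi>)
  then show ?case
    by (auto elim!: le_unionE simp: world_of_eq)
qed auto

text \<open>In nested implications an antecedent accepted at a lower point is still available at
  later ones, by persistence or by transitivity.\<close>

lemma forces_IPC:
  assumes "\<psi> \<in> IPC" "x \<in> points W M"
  shows "forces W R M x \<psi>"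
proof -
  \<comment> \<open>Reflexivity holds only on \<open>points W M\<close>, but every successor is such
    a point. It lets a forced implication be applied at the very point where its antecedent is
    forced.\<close>
  have refl: "(z, z) \<in> le_union W M" if "(y, z) \<in> le_union W M" for y z
    using that by (auto elim!: le_unionE intro: le_union_refl)
  from assms(1) show ?thesis
  proof cases
    case (1 A B)
    then show ?thesis
      by simp (meson forces_mono)
  next
    case (2 A B C)
    then show ?thesis
      by simp (meson refl le_union_trans)
  next
    case (5 A B C)
    then show ?thesis
      by simp (meson refl le_union_trans forces_mono)
  next
    case (6 A B)
    then show ?thesis
      by simp (meson forces_mono)
  qed simp_all
qed

lemma forces_derivable:
  assumes "derivable IPC \<Gamma> \<psi>" "x \<in> points W M" "\<And>\<chi>. \<chi> \<in> \<Gamma> \<Longrightarrow> forces W R M x \<chi>"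
  shows "forces W R M x \<psi>"
  using assms(1)
proof induction
  case (mp A B)
  then show ?case
    \<comment> \<open>The forced implication is used at \<open>x\<close> itself, by
      reflexivity.\<close>
    using assms(2) le_union_refl unfolding points_def by auto
qed (use assms forces_IPC in auto)

lemma mixed_model_root_theories:
  "mixed_model W R (\<lambda>w. {\<psi>. forces W R M (root_of (M w)) \<psi>})"
proof -
  have sub: "R \<subseteq> W \<times> W" and "W \<noteq> {}"
    using model unfolding concrete_mixed_model_def by blast+
  \<comment> \<open>The right-hand side depends on \<open>x\<close> only through its component
    \<open>w\<close>; \<open>R \<subseteq> W \<times> W\<close> absorbs the bound
    \<open>v \<in> W\<close> from the forcing clause.\<close>
  have box: "forces W R M x (Box \<psi>) \<longleftrightarrow> (\<forall>v. (w, v) \<in> R \<longrightarrow> forces W R M (root_of (M v)) \<psi>)"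
    if "w \<in> W" "x \<in> Dom (M w)" for w x \<psi>
    using sub that by (auto simp: world_of_eq)
  have neg_box: "forces W R M (root_of (M w)) (Neg (Box \<psi>)) \<longleftrightarrow>
      (\<exists>v. (w, v) \<in> R \<and> \<not> forces W R M (root_of (M v)) \<psi>)" if w: "w \<in> W" for w \<psi>
  proof -
    have "forces W R M (root_of (M w)) (Neg (Box \<psi>)) \<longleftrightarrow>
        (\<forall>y. (root_of (M w), y) \<in> Le (M w) \<longrightarrow> \<not> forces W R M y (Box \<psi>))"
      using le_union_iff[OF w root_of_in_Dom[OF w]]
      \<comment> \<open>The box stays folded so that \<open>box\<close> can be applied to it
        next.\<close>
      by (simp del: forces.simps(7))
    also have "\<dots> \<longleftrightarrow> \<not> forces W R M (root_of (M w)) (Box \<psi>)"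
      \<comment> \<open>Either all points of \<open>M w\<close> force the box or none does, and the
        root is among its own successors.\<close>
      using box[OF w] Le_partial_order(1)[OF w] root_of_in_Dom[OF w] root_of_Le[OF w] by blast
    finally show ?thesis
      using box[OF w root_of_in_Dom[OF w]] by blast
  qed
  show ?thesis
    unfolding mixed_model_def mem_Collect_eq
  proof (intro conjI ballI bexI[of _ IPC] allI impI)
    fix w \<psi> assume w: "w \<in> W"
    show "\<not> forces W R M (root_of (M w)) Bot"
      by simp
    show "forces W R M (root_of (M w)) \<psi>"
      if "derivable IPC {\<psi>. forces W R M (root_of (M w)) \<psi>} \<psi>"
      using forces_derivable[OF that] root_of_in_Dom[OF w] w unfolding points_def by blast
    show "forces W R M (root_of (M w)) (Box \<psi>) \<longleftrightarrow>
        (\<forall>v. (w, v) \<in> R \<longrightarrow> forces W R M (root_of (M v)) \<psi>)"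
      using box[OF w root_of_in_Dom[OF w]] .
    show "forces W R M (root_of (M w)) (Neg (Box \<psi>)) \<longleftrightarrow>
        (\<exists>v. (w, v) \<in> R \<and> \<not> forces W R M (root_of (M v)) \<psi>)"
      using neg_box[OF w] .
  qed (use sub \<open>W \<noteq> {}\<close> in auto)
qed

text \<open>Each point lies above the root of its component, so persistence applies.\<close>

lemma forces_points_if_forces_roots:
  assumes "\<And>w. w \<in> W \<Longrightarrow> forces W R M (root_of (M w)) \<psi>" "x \<in> points W M"
  shows "forces W R M x \<psi>"
  using assms forces_mono root_of_Le unfolding points_def le_union_def by blast

end

theorem theorem2p2p5:
  fixes \<phi> :: "'p form"
  assumes "MM_valid TYPE('w) \<phi>"
  shows "CMM_valid TYPE('w) TYPE('x) \<phi>"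
  unfolding CMM_valid_def
proof (intro allI impI ballI)
  fix W :: "'w set" and R and M :: "'w \<Rightarrow> ('x, 'p) kripke" and x
  assume model: "concrete_mixed_model W R M" and x: "x \<in> points W M"
  \<comment> \<open>The root theories live on the same \<open>W\<close> and \<open>R\<close>, so
    validity over the world type \<open>'w\<close> suffices, whatever the type \<open>'x\<close> of
    points.\<close>
  have "forces W R M (root_of (M w)) \<phi>" if "w \<in> W" for w
    using assms[unfolded MM_valid_def, rule_format, OF mixed_model_root_theories[OF model] that]
    by simp
  then show "forces W R M x \<phi>"
    using forces_points_if_forces_roots[OF model] x by blast
qed

end
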